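(* Consider the semidiscretization in time of the three-field Maxwell system by the TS$_4$ scheme (written out in the context), with iterates $(p^n,E^n,H^n)$, $n=0,\dots,N$. Assume positivity of inner products: the various $\langle\cdot,\cdot\rangle_\alpha$ for $\alpha=\varepsilon^{-1},\varepsilon$ and $\mu$ are all positive for all $t\in[0,T]$ for the Maxwell's solution. Then, for any fixed time step $\Delta t>0$ sufficiently small, the discrete energy $$\mathcal E^n:=\|p^{n+1}+p^n\|^2_{\varepsilon^{-1}}+2\langle p^{n+1},p^n\rangle_{\varepsilon^{-1}}+\|E^{n+1}+E^n\|^2_\varepsilon+2\langle E^{n+1},E^n\rangle_\varepsilon+\|H^{n+1}+H^n\|^2_\mu+2\langle H^{n+1},H^n\rangle_\mu$$ is conserved, that is, $\mathcal E^n=\mathcal E^{n-1}$ for $n=1,\dots,N-1$.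
   Context: **Setting.** $\Omega\subset\mathbb R^d$, $d\in\{2,3\}$, is a domain with Lipschitz boundary and unit outward normal $\mathbf n$; $T>0$; $\varepsilon,\mu$ are the (positive) material parameters. (For $d=2$ the usual two-dimensional counterparts of the operators and spaces are used.) $\langle\cdot,\cdot\rangle$ is the $L^2(\Omega)$ inner product, $\langle u,v\rangle_\alpha:=\langle\alpha u,v\rangle$ and $\|u\|_\alpha^2:=\langle u,u\rangle_\alpha$ for $\alpha\in\{\varepsilon^{-1},\varepsilon,\mu\}$. The spaces $\mathring H^1_{\varepsilon^{-1}}(\Omega)$, $\mathring H_\varepsilon(\mathrm{curl};\Omega)$, $\mathring H_\mu(\mathrm{div};\Omega)$ are $H^1(\Omega)$, $H(\mathrm{curl};\Omega)$, $H(\mathrm{div};\Omega)$ with the indicated $L^2$ weights and with homogeneous boundary conditions $p=0$, $E\times\mathbf n=0$, $H\cdot\mathbf n=0$ on $\partial\Omega$ respectively. The Maxwell system is $\partial_t p+\nabla\cdot\varepsilon E=0$, $\nabla p+\varepsilon\partial_tE-\nabla\times H=0$, $\mu\partial_tH+\nabla\times E=0$ in $\Omega\times(0,T]$ with these boundary conditions and initial conditions $p(0)=p_0$, $E(0)=E_0$, $H(0)=H_0$, where $\nabla\cdot(\varepsilon E_0)=p_0$ and $\nabla\cdot(\mu H_0)=0$. **Time grid.** $t^n=n\Delta t$, $n=0,\dots,N$, with $N\Delta t\approx T$. **TS$_4$ scheme.** Given the values at levels $0$ and $1$, for $n=1,\dots,N-1$ find $(p^{n+1},E^{n+1},H^{n+1})\in\mathring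 H^1_{\varepsilon^{-1}}(\Omega)\times\mathring H_\varepsilon(\mathrm{curl};\Omega)\times\mathring H_\mu(\mathrm{div};\Omega)$ such that for all $\tilde p,\tilde E,\tilde H$ in the same three spaces: $$\Big\langle\varepsilon^{-1}\tfrac{p^{n+1}-p^{n-1}}{2\Delta t},\tilde p\Big\rangle-\tfrac16\langle E^{n+1}+4E^n+E^{n-1},\nabla\tilde p\rangle=0,$$ $$\tfrac16\langle\nabla(p^{n+1}+4p^n+p^{n-1}),\tilde E\rangle+\Big\langle\varepsilon\tfrac{E^{n+1}-E^{n-1}}{2\Delta t},\tilde E\Big\rangle-\tfrac16\langle\nabla\times(H^{n+1}+4H^n+H^{n-1}),\tilde E\rangle=0,$$ $$\Big\langle\mu\tfrac{H^{n+1}-H^{n-1}}{2\Delta t},\tilde H\Big\rangle+\tfrac16\langle\nabla\times(E^{n+1}+4E^n+E^{n-1}),\tilde H\rangle=0.$$ Here $\langle\nabla\times H,\tilde E\rangle$ is understood as $\langle H,\nabla\times\tilde E\rangle$ (integration by parts with $\tilde E\times\mathbf n=0$). *)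

theory Defs
  imports "HOL-Analysis.Analysis"
begin

text \<open>Lebesgue spaces. Functions are representatives of their almost-everywhere classes; only
  their values on \<open>\<Omega>\<close> matter.\<close>

definition L2 :: "'a::euclidean_space set \<Rightarrow> ('a \<Rightarrow> 'b::euclidean_space) set" where
  "L2 \<Omega> = {u. u \<in> borel_measurable (lebesgue_on \<Omega>) \<and>
                integrable (lebesgue_on \<Omega>) (\<lambda>x. (norm (u x))\<^sup>2)}"

definition L2_inner ::
    "'a::euclidean_space set \<Rightarrow> ('a \<Rightarrow> 'b::euclidean_space) \<Rightarrow> ('a \<Rightarrow> 'b) \<Rightarrow> real" where
  "L2_inner \<Omega> u v = (LINT x|lebesgue_on \<Omega>. u x \<bullet> v x)"

definition L2_norm :: "'a::euclidean_space set \<Rightarrow> ('a \<Rightarrow> 'b::euclidean_space) \<Rightarrow> real" where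
  "L2_norm \<Omega> u = sqrt (L2_inner \<Omega> u u)"

definition wt_inner ::
    "'a::euclidean_space set \<Rightarrow> ('a \<Rightarrow> real) \<Rightarrow> ('a \<Rightarrow> 'b::euclidean_space) \<Rightarrow> ('a \<Rightarrow> 'b) \<Rightarrow> real" where
  "wt_inner \<Omega> \<alpha> u v = L2_inner \<Omega> (\<lambda>x. \<alpha> x *\<^sub>R u x) v"

definition wt_norm_sq ::
    "'a::euclidean_space set \<Rightarrow> ('a \<Rightarrow> real) \<Rightarrow> ('a \<Rightarrow> 'b::euclidean_space) \<Rightarrow> real" where
  "wt_norm_sq \<Omega> \<alpha> u = wt_inner \<Omega> \<alpha> u u"

text \<open>Material parameters are scalar functions bounded above and away from zero, so a weight
  changes the inner product of an \<open>L\<^sup>2\<close>-based space but not the set of its elements.\<close>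

definition material :: "'a::euclidean_space set \<Rightarrow> ('a \<Rightarrow> real) \<Rightarrow> bool" where
  "material \<Omega> \<alpha> \<longleftrightarrow> \<alpha> \<in> borel_measurable (lebesgue_on \<Omega>) \<and>
     (\<exists>c C. 0 < c \<and> (\<forall>x\<in>\<Omega>. c \<le> \<alpha> x \<and> \<alpha> x \<le> C))"

text \<open>Near each boundary point, \<open>\<Omega>\<close> is the strict epigraph, in some direction \<open>\<nu>\<close>, of a Lipschitz
  function on the hyperplane orthogonal to \<open>\<nu>\<close>. Boundedness of \<open>\<Omega>\<close> is not required.\<close>

definition lipschitz_domain :: "'a::euclidean_space set \<Rightarrow> bool" where
  "lipschitz_domain \<Omega> \<longleftrightarrow> open \<Omega> \<and> connected \<Omega> \<and> \<Omega> \<noteq> {} \<and>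
     (\<forall>x\<in>frontier \<Omega>. \<exists>r>0. \<exists>\<nu>. norm \<nu> = 1 \<and> (\<exists>L g. L-lipschitz_on {z. z \<bullet> \<nu> = 0} g \<and>
        \<Omega> \<inter> ball x r = {y \<in> ball x r. g (y - (y \<bullet> \<nu>) *\<^sub>R \<nu>) < y \<bullet> \<nu>}))"

primrec Ck :: "nat \<Rightarrow> ('a::euclidean_space \<Rightarrow> 'b::euclidean_space) \<Rightarrow> bool" where
  "Ck 0 f = continuous_on UNIV f"
| "Ck (Suc k) f = ((\<forall>x. f differentiable (at x)) \<and>
     (\<forall>b\<in>Basis. Ck k (\<lambda>x. frechet_derivative f (at x) b)))"

definition test_function ::
    "'a::euclidean_space set \<Rightarrow> ('a \<Rightarrow> 'b::euclidean_space) \<Rightarrow> bool" where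
  "test_function \<Omega> \<phi> \<longleftrightarrow> (\<forall>k. Ck k \<phi>) \<and>
     compact (closure {x. \<phi> x \<noteq> 0}) \<and> closure {x. \<phi> x \<noteq> 0} \<subseteq> \<Omega>"

text \<open>Classical differential operators, to be applied to test functions.\<close>

definition grad :: "('a::euclidean_space \<Rightarrow> real) \<Rightarrow> 'a \<Rightarrow> 'a" where
  "grad \<phi> x = (\<Sum>b\<in>Basis. frechet_derivative \<phi> (at x) b *\<^sub>R b)"

definition divg :: "('a::euclidean_space \<Rightarrow> 'a) \<Rightarrow> 'a \<Rightarrow> real" where
  "divg \<psi> x = (\<Sum>b\<in>Basis. frechet_derivative \<psi> (at x) b \<bullet> b)"

definition pd :: "'n::finite \<Rightarrow> (real^'n \<Rightarrow> 'b::euclidean_space) \<Rightarrow> real^'n \<Rightarrow> 'b" where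
  "pd i f x = frechet_derivative f (at x) (axis i 1)"

definition curl3 :: "(real^3 \<Rightarrow> real^3) \<Rightarrow> real^3 \<Rightarrow> real^3" where
  "curl3 u x = vector [pd 2 u x $ 3 - pd 3 u x $ 2,
                       pd 3 u x $ 1 - pd 1 u x $ 3,
                       pd 1 u x $ 2 - pd 2 u x $ 1]"

text \<open>In two dimensions the curl of a vector field is a scalar and the curl of a scalar is a vector
  field: these are the nonzero components of the three-dimensional curl of \<open>(u\<^sub>1, u\<^sub>2, 0)\<close> and of
  \<open>(0, 0, h)\<close>, for fields independent of the third coordinate.\<close>

definition scurl2 :: "(real^2 \<Rightarrow> real^2) \<Rightarrow> real^2 \<Rightarrow> real" where
  "scurl2 u x = pd 1 u x $ 2 - pd 2 u x $ 1"

definition vcurl2 :: "(real^2 \<Rightarrow> real) \<Rightarrow> real^2 \<Rightarrow> real^2" where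
  "vcurl2 h x = vector [pd 2 h x, - pd 1 h x]"

text \<open>Weak derivatives in \<open>L\<^sup>2\<close>. A differential operator \<open>D\<close> is given by its formal adjoint \<open>D'\<close>
  acting on test functions: \<open>-divg\<close> for the gradient, \<open>-grad\<close> for the divergence, \<open>curl3\<close> for
  itself, and \<open>vcurl2\<close> and \<open>scurl2\<close> for each other.\<close>

definition has_weak ::
    "'a::euclidean_space set \<Rightarrow> (('a \<Rightarrow> 'c::euclidean_space) \<Rightarrow> 'a \<Rightarrow> 'b::euclidean_space) \<Rightarrow>
     ('a \<Rightarrow> 'b) \<Rightarrow> ('a \<Rightarrow> 'c) \<Rightarrow> bool" where
  "has_weak \<Omega> D' u w \<longleftrightarrow> u \<in> L2 \<Omega> \<and> w \<in> L2 \<Omega> \<and>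
     (\<forall>\<psi>. test_function \<Omega> \<psi> \<longrightarrow> L2_inner \<Omega> w \<psi> = L2_inner \<Omega> u (D' \<psi>))"

definition weak ::
    "'a::euclidean_space set \<Rightarrow> (('a \<Rightarrow> 'c::euclidean_space) \<Rightarrow> 'a \<Rightarrow> 'b::euclidean_space) \<Rightarrow>
     ('a \<Rightarrow> 'b) \<Rightarrow> ('a \<Rightarrow> 'c)" where
  "weak \<Omega> D' u = (SOME w. has_weak \<Omega> D' u w)"

abbreviation grad_adj :: "('a::euclidean_space \<Rightarrow> 'a) \<Rightarrow> 'a \<Rightarrow> real" where
  "grad_adj \<equiv> \<lambda>\<psi> x. - divg \<psi> x"

abbreviation divg_adj :: "('a::euclidean_space \<Rightarrow> real) \<Rightarrow> 'a \<Rightarrow> 'a" where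
  "divg_adj \<equiv> \<lambda>\<phi> x. - grad \<phi> x"

text \<open>The space \<open>H(D; \<Omega>)\<close> with homogeneous boundary condition, as the closure of the test functions
  in the graph norm. On a Lipschitz domain this is the kernel of the corresponding trace:
  \<open>p = 0\<close> for the gradient, \<open>E \<times> n = 0\<close> for the curl, \<open>H \<bullet> n = 0\<close> for the divergence.\<close>

definition graph_space0 ::
    "'a::euclidean_space set \<Rightarrow> (('a \<Rightarrow> 'b::euclidean_space) \<Rightarrow> 'a \<Rightarrow> 'c::euclidean_space) \<Rightarrow>
     (('a \<Rightarrow> 'c) \<Rightarrow> 'a \<Rightarrow> 'b) \<Rightarrow> ('a \<Rightarrow> 'b) set" where
  "graph_space0 \<Omega> D D' = {u. \<exists>w. has_weak \<Omega> D' u w \<and>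
     (\<exists>\<phi>. (\<forall>k::nat. test_function \<Omega> (\<phi> k)) \<and>
          (\<lambda>k. L2_norm \<Omega> (\<lambda>x. \<phi> k x - u x)) \<longlonglongrightarrow> 0 \<and>
          (\<lambda>k. L2_norm \<Omega> (\<lambda>x. D (\<phi> k) x - w x)) \<longlonglongrightarrow> 0)}"

definition H1_0 :: "'a::euclidean_space set \<Rightarrow> ('a \<Rightarrow> real) set" where
  "H1_0 \<Omega> = graph_space0 \<Omega> grad grad_adj"

definition Hdiv_0 :: "'a::euclidean_space set \<Rightarrow> ('a \<Rightarrow> 'a) set" where
  "Hdiv_0 \<Omega> = graph_space0 \<Omega> divg divg_adj"

definition L2_continuous ::
    "'a::euclidean_space set \<Rightarrow> real \<Rightarrow> (real \<Rightarrow> 'a \<Rightarrow> 'b::euclidean_space) \<Rightarrow> bool" where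
  "L2_continuous \<Omega> T u \<longleftrightarrow> (\<forall>t\<in>{0..T}. u t \<in> L2 \<Omega> \<and>
     ((\<lambda>s. L2_norm \<Omega> (\<lambda>x. u s x - u t x)) \<longlongrightarrow> 0) (at t within {0..T}))"

definition has_L2_time_deriv ::
    "'a::euclidean_space set \<Rightarrow> real \<Rightarrow> (real \<Rightarrow> 'a \<Rightarrow> 'b::euclidean_space) \<Rightarrow> ('a \<Rightarrow> 'b) \<Rightarrow>
     real \<Rightarrow> bool" where
  "has_L2_time_deriv \<Omega> T u u' t \<longleftrightarrow> u' \<in> L2 \<Omega> \<and>
     ((\<lambda>s. L2_norm \<Omega> (\<lambda>x. (u s x - u t x) /\<^sub>R (s - t) - u' x)) \<longlongrightarrow> 0) (at t within {0..T})"

text \<open>Both dimensions are covered by two parameters for the curl and one for the space of magnetic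
  fields: \<open>C\<close> is the curl acting on electric fields, \<open>C'\<close> its formal adjoint acting on magnetic
  fields, and \<open>V\<close> the space of magnetic fields with boundary condition. For \<open>d = 3\<close> they are
  \<open>curl3\<close>, \<open>curl3\<close>, \<open>Hdiv_0 \<Omega>\<close>. For \<open>d = 2\<close> they are \<open>scurl2\<close>, \<open>vcurl2\<close>, \<open>L2 \<Omega>\<close>: for the
  scalar magnetic field \<open>(0, 0, h)\<close> both the divergence and the normal component vanish identically.
  The weak curl of \<open>E\<close> is tested through \<open>C'\<close>, that of \<open>H\<close> through \<open>C\<close>.\<close>

definition maxwell_solution ::
    "'a::euclidean_space set \<Rightarrow> (('a \<Rightarrow> 'a) \<Rightarrow> 'a \<Rightarrow> 'h::euclidean_space) \<Rightarrow>
     (('a \<Rightarrow> 'h) \<Rightarrow> 'a \<Rightarrow> 'a) \<Rightarrow> ('a \<Rightarrow> 'h) set \<Rightarrow> ('a \<Rightarrow> real) \<Rightarrow> ('a \<Rightarrow> real) \<Rightarrow> real \<Rightarrow>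
     ('a \<Rightarrow> real) \<Rightarrow> ('a \<Rightarrow> 'a) \<Rightarrow> ('a \<Rightarrow> 'h) \<Rightarrow>
     (real \<Rightarrow> 'a \<Rightarrow> real) \<Rightarrow> (real \<Rightarrow> 'a \<Rightarrow> 'a) \<Rightarrow> (real \<Rightarrow> 'a \<Rightarrow> 'h) \<Rightarrow> bool" where
  "maxwell_solution \<Omega> C C' V \<epsilon> \<mu> T p0 E0 H0 p E H \<longleftrightarrow>
     L2_continuous \<Omega> T p \<and> L2_continuous \<Omega> T E \<and> L2_continuous \<Omega> T H \<and>
     (AE x in lebesgue_on \<Omega>. p 0 x = p0 x \<and> E 0 x = E0 x \<and> H 0 x = H0 x) \<and>
     (\<forall>t\<in>{0<..T}. p t \<in> H1_0 \<Omega> \<and> E t \<in> graph_space0 \<Omega> C C' \<and> H t \<in> V \<and>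
        (\<exists>p' E' H'.
           has_L2_time_deriv \<Omega> T p p' t \<and>
           has_L2_time_deriv \<Omega> T E E' t \<and>
           has_L2_time_deriv \<Omega> T H H' t \<and>
           has_weak \<Omega> divg_adj (\<lambda>x. \<epsilon> x *\<^sub>R E t x) (\<lambda>x. - p' x) \<and>
           has_weak \<Omega> C (H t) (\<lambda>x. weak \<Omega> grad_adj (p t) x + \<epsilon> x *\<^sub>R E' x) \<and>
           has_weak \<Omega> C' (E t) (\<lambda>x. - (\<mu> x *\<^sub>R H' x))))"

definition positive_inner_products ::
    "'a::euclidean_space set \<Rightarrow> ('a \<Rightarrow> real) \<Rightarrow> ('a \<Rightarrow> real) \<Rightarrow> real \<Rightarrow>
     (real \<Rightarrow> 'a \<Rightarrow> real) \<Rightarrow> (real \<Rightarrow> 'a \<Rightarrow> 'a) \<Rightarrow> (real \<Rightarrow> 'a \<Rightarrow> 'h::euclidean_space) \<Rightarrow> bool" where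
  "positive_inner_products \<Omega> \<epsilon> \<mu> T p E H \<longleftrightarrow>
     (\<forall>t\<in>{0..T}. wt_inner \<Omega> (\<lambda>x. inverse (\<epsilon> x)) (p t) (p t) > 0 \<and>
        wt_inner \<Omega> \<epsilon> (E t) (E t) > 0 \<and> wt_inner \<Omega> \<mu> (H t) (H t) > 0)"

definition centered_diff ::
    "real \<Rightarrow> (nat \<Rightarrow> 'a \<Rightarrow> 'b::real_vector) \<Rightarrow> nat \<Rightarrow> 'a \<Rightarrow> 'b" where
  "centered_diff dt u n = (\<lambda>x. (u (n + 1) x - u (n - 1) x) /\<^sub>R (2 * dt))"

definition simpson_sum :: "(nat \<Rightarrow> 'a \<Rightarrow> 'b::real_vector) \<Rightarrow> nat \<Rightarrow> 'a \<Rightarrow> 'b" where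
  "simpson_sum u n = (\<lambda>x. u (n + 1) x + 4 *\<^sub>R u n x + u (n - 1) x)"

text \<open>In the second equation the term with the curl of \<open>H\<close> is in its integrated-by-parts form, the
  curl falling on the electric test field.\<close>

definition TS4_scheme ::
    "'a::euclidean_space set \<Rightarrow> (('a \<Rightarrow> 'a) \<Rightarrow> 'a \<Rightarrow> 'h::euclidean_space) \<Rightarrow>
     (('a \<Rightarrow> 'h) \<Rightarrow> 'a \<Rightarrow> 'a) \<Rightarrow> ('a \<Rightarrow> 'h) set \<Rightarrow> ('a \<Rightarrow> real) \<Rightarrow> ('a \<Rightarrow> real) \<Rightarrow> real \<Rightarrow> nat \<Rightarrow>
     (nat \<Rightarrow> 'a \<Rightarrow> real) \<Rightarrow> (nat \<Rightarrow> 'a \<Rightarrow> 'a) \<Rightarrow> (nat \<Rightarrow> 'a \<Rightarrow> 'h) \<Rightarrow> bool" where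
  "TS4_scheme \<Omega> C C' V \<epsilon> \<mu> dt N p E H \<longleftrightarrow>
     (\<forall>n\<le>N. p n \<in> H1_0 \<Omega> \<and> E n \<in> graph_space0 \<Omega> C C' \<and> H n \<in> V) \<and>
     (\<forall>n. 1 \<le> n \<and> n < N \<longrightarrow>
       (\<forall>q\<in>H1_0 \<Omega>. \<forall>F\<in>graph_space0 \<Omega> C C'. \<forall>G\<in>V.
          wt_inner \<Omega> (\<lambda>x. inverse (\<epsilon> x)) (centered_diff dt p n) q
            - 1 / 6 * L2_inner \<Omega> (simpson_sum E n) (weak \<Omega> grad_adj q) = 0 \<and>
          1 / 6 * L2_inner \<Omega> (weak \<Omega> grad_adj (simpson_sum p n)) F
            + wt_inner \<Omega> \<epsilon> (centered_diff dt E n) F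
            - 1 / 6 * L2_inner \<Omega> (simpson_sum H n) (weak \<Omega> C' F) = 0 \<and>
          wt_inner \<Omega> \<mu> (centered_diff dt H n) G
            + 1 / 6 * L2_inner \<Omega> (weak \<Omega> C' (simpson_sum E n)) G = 0))"

definition TS4_energy ::
    "'a::euclidean_space set \<Rightarrow> ('a \<Rightarrow> real) \<Rightarrow> ('a \<Rightarrow> real) \<Rightarrow>
     (nat \<Rightarrow> 'a \<Rightarrow> real) \<Rightarrow> (nat \<Rightarrow> 'a \<Rightarrow> 'a) \<Rightarrow> (nat \<Rightarrow> 'a \<Rightarrow> 'h::euclidean_space) \<Rightarrow> nat \<Rightarrow> real" where
  "TS4_energy \<Omega> \<epsilon> \<mu> p E H n =
     wt_norm_sq \<Omega> (\<lambda>x. inverse (\<epsilon> x)) (\<lambda>x. p (n + 1) x + p n x)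
       + 2 * wt_inner \<Omega> (\<lambda>x. inverse (\<epsilon> x)) (p (n + 1)) (p n)
     + wt_norm_sq \<Omega> \<epsilon> (\<lambda>x. E (n + 1) x + E n x) + 2 * wt_inner \<Omega> \<epsilon> (E (n + 1)) (E n)
     + wt_norm_sq \<Omega> \<mu> (\<lambda>x. H (n + 1) x + H n x) + 2 * wt_inner \<Omega> \<mu> (H (n + 1)) (H n)"

end

theory Submission imports Defs
begin

text \<open>Writing \<open>a, b, c\<close> for the values of one field at the levels \<open>n + 1, n, n - 1\<close>, its
  contribution to the energy increment is
  \<open>\<parallel>a\<parallel>\<^sup>2 + 4\<langle>a, b\<rangle> - 4\<langle>b, c\<rangle> - \<parallel>c\<parallel>\<^sup>2 = \<langle>a - c, a + 4b + c\<rangle>\<close>. Testing the scheme with the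
  Simpson sums \<open>a + 4b + c\<close> of the three fields and adding the equations, the increment becomes a
  combination of the gradient and curl terms, which cancel in pairs by symmetry of the inner
  product. The analytic content is that the Simpson sums are admissible test functions, i.e. that
  the closure of the test functions in the graph norm is a linear space.\<close>

section \<open>Linear structure, inner product and norm of \<open>L2\<close>\<close>

lemma L2_lincomb:
  fixes u v :: "'a::euclidean_space \<Rightarrow> 'b::euclidean_space"
  assumes "u \<in> L2 \<Omega>" "v \<in> L2 \<Omega>"
  shows "(\<lambda>x. a *\<^sub>R u x + b *\<^sub>R v x) \<in> L2 \<Omega>"
proof -
  have m: "u \<in> borel_measurable (lebesgue_on \<Omega>)" "v \<in> borel_measurable (lebesgue_on \<Omega>)"
    and i: "integrable (lebesgue_on \<Omega>) (\<lambda>x. (norm (u x))\<^sup>2)"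
      "integrable (lebesgue_on \<Omega>) (\<lambda>x. (norm (v x))\<^sup>2)"
    using assms by (auto simp: L2_def)
  have le: "(norm (a *\<^sub>R s + b *\<^sub>R t))\<^sup>2 \<le> 2 * a\<^sup>2 * (norm s)\<^sup>2 + 2 * b\<^sup>2 * (norm t)\<^sup>2" for s t :: 'b
  proof -
    have "(norm (a *\<^sub>R s + b *\<^sub>R t))\<^sup>2 \<le> (norm (a *\<^sub>R s) + norm (b *\<^sub>R t))\<^sup>2"
      by (intro power_mono norm_triangle_ineq) auto
    also have "\<dots> \<le> 2 * (norm (a *\<^sub>R s))\<^sup>2 + 2 * (norm (b *\<^sub>R t))\<^sup>2"
      \<comment> \<open>With second argument 0 this is nonnegativity of the square of the difference
        of the two norms, which bounds the mixed term.\<close>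
      using sum_squares_ge_zero[of "norm (a *\<^sub>R s) - norm (b *\<^sub>R t)" 0]
      by (simp add: power2_eq_square algebra_simps)
    finally show ?thesis by (simp add: power_mult_distrib)
  qed
  have "integrable (lebesgue_on \<Omega>) (\<lambda>x. (norm (a *\<^sub>R u x + b *\<^sub>R v x))\<^sup>2)"
  proof (rule Bochner_Integration.integrable_bound)
    show "integrable (lebesgue_on \<Omega>) (\<lambda>x. 2 * a\<^sup>2 * (norm (u x))\<^sup>2 + 2 * b\<^sup>2 * (norm (v x))\<^sup>2)"
      using i by (intro Bochner_Integration.integrable_add integrable_mult_right) auto
    show "(\<lambda>x. (norm (a *\<^sub>R u x + b *\<^sub>R v x))\<^sup>2) \<in> borel_measurable (lebesgue_on \<Omega>)"
      using m by measurable
    have "norm ((norm (a *\<^sub>R u x + b *\<^sub>R v x))\<^sup>2)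
        \<le> norm (2 * a\<^sup>2 * (norm (u x))\<^sup>2 + 2 * b\<^sup>2 * (norm (v x))\<^sup>2)" for x
      unfolding real_norm_def abs_power2 by (rule order_trans[OF le abs_ge_self])
    then show "AE x in lebesgue_on \<Omega>. norm ((norm (a *\<^sub>R u x + b *\<^sub>R v x))\<^sup>2)
        \<le> norm (2 * a\<^sup>2 * (norm (u x))\<^sup>2 + 2 * b\<^sup>2 * (norm (v x))\<^sup>2)"
      by (rule AE_I2)
  qed
  then show ?thesis
    using m unfolding L2_def by (auto intro!: borel_measurable_add borel_measurable_scaleR)
qed

lemma L2_scaleR:
  assumes "u \<in> L2 \<Omega>"
  shows "(\<lambda>x. a *\<^sub>R u x) \<in> L2 \<Omega>"
  using L2_lincomb[OF assms assms, of a 0] by simp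

lemma L2_diff:
  assumes "u \<in> L2 \<Omega>" "v \<in> L2 \<Omega>"
  shows "(\<lambda>x. u x - v x) \<in> L2 \<Omega>"
  using L2_lincomb[OF assms, of 1 "-1"] by simp

text \<open>The Bochner integral is additive only on integrable functions, so each later expansion
  of an inner product rests on this bound by the two squared norms.\<close>

lemma L2_integrable_inner:
  fixes u v :: "'a::euclidean_space \<Rightarrow> 'b::euclidean_space"
  assumes "u \<in> L2 \<Omega>" "v \<in> L2 \<Omega>"
  shows "integrable (lebesgue_on \<Omega>) (\<lambda>x. u x \<bullet> v x)"
proof -
  have m: "u \<in> borel_measurable (lebesgue_on \<Omega>)" "v \<in> borel_measurable (lebesgue_on \<Omega>)"
    and i: "integrable (lebesgue_on \<Omega>) (\<lambda>x. (norm (u x))\<^sup>2)"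
      "integrable (lebesgue_on \<Omega>) (\<lambda>x. (norm (v x))\<^sup>2)"
    using assms by (auto simp: L2_def)
  have le: "\<bar>s \<bullet> t\<bar> \<le> (norm s)\<^sup>2 + (norm t)\<^sup>2" for s t :: 'b
  proof -
    have "\<bar>s \<bullet> t\<bar> \<le> norm s * norm t"
      by (rule Cauchy_Schwarz_ineq2)
    also have "\<dots> \<le> 2 * (norm s * norm t)"
      by simp
    also have "\<dots> \<le> (norm s)\<^sup>2 + (norm t)\<^sup>2"
      using sum_squares_bound[of "norm s" "norm t"] by (simp add: mult.assoc)
    finally show ?thesis .
  qed
  show ?thesis
  proof (rule Bochner_Integration.integrable_bound)
    show "integrable (lebesgue_on \<Omega>) (\<lambda>x. (norm (u x))\<^sup>2 + (norm (v x))\<^sup>2)"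
      using i by (rule Bochner_Integration.integrable_add)
    show "(\<lambda>x. u x \<bullet> v x) \<in> borel_measurable (lebesgue_on \<Omega>)"
      using m by measurable
    have "norm (u x \<bullet> v x) \<le> norm ((norm (u x))\<^sup>2 + (norm (v x))\<^sup>2)" for x
      unfolding real_norm_def by (rule order_trans[OF le abs_ge_self])
    then show "AE x in lebesgue_on \<Omega>. norm (u x \<bullet> v x) \<le> norm ((norm (u x))\<^sup>2 + (norm (v x))\<^sup>2)"
      by (rule AE_I2)
  qed
qed

lemma L2_inner_commute: "L2_inner \<Omega> u v = L2_inner \<Omega> v u"
  by (simp add: L2_inner_def inner_commute)

lemma L2_inner_lincomb_left:
  assumes "u \<in> L2 \<Omega>" "v \<in> L2 \<Omega>" "w \<in> L2 \<Omega>"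
  shows "L2_inner \<Omega> (\<lambda>x. a *\<^sub>R u x + b *\<^sub>R v x) w = a * L2_inner \<Omega> u w + b * L2_inner \<Omega> v w"
  using L2_integrable_inner[OF assms(1,3)] L2_integrable_inner[OF assms(2,3)]
  by (simp add: L2_inner_def inner_add_left)

lemma L2_norm_nonneg: "0 \<le> L2_norm \<Omega> u"
  by (simp add: L2_norm_def L2_inner_def)

lemma L2_norm_scaleR: "L2_norm \<Omega> (\<lambda>x. a *\<^sub>R u x) = \<bar>a\<bar> * L2_norm \<Omega> u"
proof -
  have "L2_inner \<Omega> (\<lambda>x. a *\<^sub>R u x) (\<lambda>x. a *\<^sub>R u x) = a\<^sup>2 * L2_inner \<Omega> u u"
    by (simp add: L2_inner_def power2_eq_square mult.assoc)
  then show ?thesis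
    by (simp add: L2_norm_def real_sqrt_mult)
qed

lemma L2_inner_self_add_le:
  assumes "u \<in> L2 \<Omega>" "v \<in> L2 \<Omega>"
  shows "L2_inner \<Omega> (\<lambda>x. u x + v x) (\<lambda>x. u x + v x) \<le> 2 * (L2_inner \<Omega> u u + L2_inner \<Omega> v v)"
proof -
  note i = L2_integrable_inner[OF assms(1) assms(1)] L2_integrable_inner[OF assms(2) assms(2)]
    L2_integrable_inner[OF L2_lincomb[OF assms, of 1 1] L2_lincomb[OF assms, of 1 1]]
  \<comment> \<open>This is the parallelogram law with the square of \<open>s - t\<close>
    dropped.\<close>
  have "(s + t) \<bullet> (s + t) \<le> 2 * (s \<bullet> s + t \<bullet> t)" for s t :: 'b
    using inner_ge_zero[of "s - t"] by (simp add: inner_add inner_diff inner_commute)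
  then have "L2_inner \<Omega> (\<lambda>x. u x + v x) (\<lambda>x. u x + v x)
      \<le> (LINT x|lebesgue_on \<Omega>. 2 * (u x \<bullet> u x + v x \<bullet> v x))"
    unfolding L2_inner_def using i by (intro integral_mono) auto
  also have "\<dots> = 2 * (L2_inner \<Omega> u u + L2_inner \<Omega> v v)"
    using i by (simp add: L2_inner_def)
  finally show ?thesis .
qed

text \<open>A triangle inequality up to a constant: the pointwise bound on the square of a sum is
  integrated, and the square root is subadditive. The factor \<open>sqrt 2\<close> is harmless
  because the estimate only serves to show that norms tend to 0.\<close>

lemma L2_norm_add_le:
  assumes "u \<in> L2 \<Omega>" "v \<in> L2 \<Omega>"
  shows "L2_norm \<Omega> (\<lambda>x. u x + v x) \<le> sqrt 2 * (L2_norm \<Omega> u + L2_norm \<Omega> v)"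
proof -
  have nn: "0 \<le> L2_inner \<Omega> w w" for w :: "'a \<Rightarrow> 'b"
    by (simp add: L2_inner_def)
  have "L2_norm \<Omega> (\<lambda>x. u x + v x) \<le> sqrt (2 * (L2_inner \<Omega> u u + L2_inner \<Omega> v v))"
    unfolding L2_norm_def using L2_inner_self_add_le[OF assms] by simp
  also have "\<dots> \<le> sqrt 2 * (sqrt (L2_inner \<Omega> u u) + sqrt (L2_inner \<Omega> v v))"
    unfolding real_sqrt_mult by (intro mult_left_mono sqrt_add_le_add_sqrt nn) auto
  finally show ?thesis by (simp add: L2_norm_def)
qed

text \<open>Serves both convergences in the definition of \<open>graph_space0\<close>: that of the
  approximating test functions and that of their images under the operator.\<close>

lemma L2_norm_lincomb_tendsto_0:
  assumes "\<And>k. f k \<in> L2 \<Omega>" "\<And>k. g k \<in> L2 \<Omega>" "u \<in> L2 \<Omega>" "v \<in> L2 \<Omega>"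
    and "(\<lambda>k. L2_norm \<Omega> (\<lambda>x. f k x - u x)) \<longlonglongrightarrow> 0"
    and "(\<lambda>k. L2_norm \<Omega> (\<lambda>x. g k x - v x)) \<longlonglongrightarrow> 0"
  shows "(\<lambda>k::nat. L2_norm \<Omega> (\<lambda>x. (a *\<^sub>R f k x + b *\<^sub>R g k x) - (a *\<^sub>R u x + b *\<^sub>R v x))) \<longlonglongrightarrow> 0"
proof (rule tendsto_sandwich[OF _ _ tendsto_const])
  let ?r = "\<lambda>k. sqrt 2 * (\<bar>a\<bar> * L2_norm \<Omega> (\<lambda>x. f k x - u x) + \<bar>b\<bar> * L2_norm \<Omega> (\<lambda>x. g k x - v x))"
  show "?r \<longlonglongrightarrow> 0"
    by (rule tendsto_eq_intros assms(5,6) refl | simp)+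
  have "(a *\<^sub>R f k x + b *\<^sub>R g k x) - (a *\<^sub>R u x + b *\<^sub>R v x)
      = a *\<^sub>R (f k x - u x) + b *\<^sub>R (g k x - v x)" for k x
    by (simp add: algebra_simps)
  then have "L2_norm \<Omega> (\<lambda>x. (a *\<^sub>R f k x + b *\<^sub>R g k x) - (a *\<^sub>R u x + b *\<^sub>R v x)) \<le> ?r k" for k
    using L2_norm_add_le[OF L2_scaleR[OF L2_diff[OF assms(1,3)]] L2_scaleR[OF L2_diff[OF assms(2,4)]],
        of a k b k]
    by (simp only: L2_norm_scaleR)
  then show "\<forall>\<^sub>F k in sequentially. L2_norm \<Omega> (\<lambda>x. (a *\<^sub>R f k x + b *\<^sub>R g k x) - (a *\<^sub>R u x + b *\<^sub>R v x)) \<le> ?r k"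
    by simp
qed (simp add: L2_norm_nonneg)

section \<open>Test functions and first-order operators acting on them\<close>

lemma compact_support_in_L2:
  fixes f :: "'a::euclidean_space \<Rightarrow> 'b::euclidean_space"
  assumes "open \<Omega>" "continuous_on UNIV f" "compact K" "\<And>x. x \<notin> K \<Longrightarrow> f x = 0"
  shows "f \<in> L2 \<Omega>"
proof -
  have s: "\<Omega> \<in> sets lebesgue"
    using assms(1) by auto
  have m: "f \<in> borel_measurable (lebesgue_on \<Omega>)"
    using assms(2) s
    by (intro continuous_imp_measurable_on_sets_lebesgue continuous_on_subset[OF assms(2)]) auto
  \<comment> \<open>Integrability is obtained for Borel measure on the whole space, transferred to
    its completion, and only then restricted to \<open>\<Omega>\<close>.\<close>
  have "integrable lborel (\<lambda>x. indicator K x *\<^sub>R (norm (f x))\<^sup>2)"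
    by (intro borel_integrable_compact assms continuous_intros continuous_on_subset[OF assms(2)]) auto
  also have "(\<lambda>x. indicator K x *\<^sub>R (norm (f x))\<^sup>2) = (\<lambda>x. (norm (f x))\<^sup>2)"
    using assms(4) by (auto simp: fun_eq_iff indicator_def)
  finally have "integrable lebesgue (\<lambda>x. (norm (f x))\<^sup>2)"
    by (rule integrable_completion[THEN iffD2, rotated]) (simp add: borel_measurable_continuous_onI assms continuous_on_norm continuous_on_power)
  then have "integrable (lebesgue_on \<Omega>) (\<lambda>x. (norm (f x))\<^sup>2)"
    using integrable_mult_indicator[OF s, of "\<lambda>x. (norm (f x))\<^sup>2"] s
    by (simp add: integrable_restrict_space)
  with m show ?thesis by (simp add: L2_def)
qed

lemma frechet_derivative_lincomb:
  fixes f g :: "'a::euclidean_space \<Rightarrow> 'b::euclidean_space"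
  assumes "f differentiable (at x)" "g differentiable (at x)"
  shows "frechet_derivative (\<lambda>x. a *\<^sub>R f x + b *\<^sub>R g x) (at x) =
    (\<lambda>h. a *\<^sub>R frechet_derivative f (at x) h + b *\<^sub>R frechet_derivative g (at x) h)"
  using assms unfolding frechet_derivative_works
  by (intro frechet_derivative_at[symmetric] has_derivative_add has_derivative_scaleR_right)

lemma Ck_lincomb:
  assumes "Ck k f" "Ck k g"
  shows "Ck k (\<lambda>x. a *\<^sub>R f x + b *\<^sub>R g x)"
  using assms
proof (induction k arbitrary: f g)
  case 0
  then show ?case by (auto intro!: continuous_intros)
next
  case (Suc k)
  then show ?case by (simp add: frechet_derivative_lincomb)
qed

lemma test_function_lincomb:
  assumes "test_function \<Omega> f" "test_function \<Omega> g"
  shows "test_function \<Omega> (\<lambda>x. a *\<^sub>R f x + b *\<^sub>R g x)"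
proof -
  let ?S = "\<lambda>h. closure {x. h x \<noteq> 0}"
  have sub: "?S (\<lambda>x. a *\<^sub>R f x + b *\<^sub>R g x) \<subseteq> ?S f \<union> ?S g"
    unfolding closure_Un[symmetric] by (intro closure_mono) auto
  have "compact (?S f \<union> ?S g)"
    using assms by (auto simp: test_function_def)
  \<comment> \<open>The support of the combination is a closed subset of this compact union;
    intersecting the two leaves it unchanged.\<close>
  then have "compact ((?S f \<union> ?S g) \<inter> ?S (\<lambda>x. a *\<^sub>R f x + b *\<^sub>R g x))"
    by (rule compact_Int_closed) simp
  then have "compact (?S (\<lambda>x. a *\<^sub>R f x + b *\<^sub>R g x))"
    unfolding Int_absorb1[OF sub] .
  moreover have "?S (\<lambda>x. a *\<^sub>R f x + b *\<^sub>R g x) \<subseteq> \<Omega>"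
    using sub assms by (auto simp: test_function_def)
  ultimately show ?thesis
    using assms by (simp add: test_function_def Ck_lincomb)
qed

lemma test_function_in_L2:
  assumes "open \<Omega>" "test_function \<Omega> f"
  shows "f \<in> L2 \<Omega>"
proof (rule compact_support_in_L2[OF assms(1)])
  have "Ck 0 f"
    using assms(2) by (simp only: test_function_def)
  then show "continuous_on UNIV f"
    by simp
  show "compact (closure {x. f x \<noteq> 0})"
    using assms(2) by (simp add: test_function_def)
  show "f x = 0" if "x \<notin> closure {x. f x \<noteq> 0}" for x
    using that closure_subset[of "{x. f x \<noteq> 0}"] by auto
qed

lemma test_function_differentiable:
  assumes "test_function \<Omega> f"
  shows "f differentiable (at x)"
proof -
  have "Ck (Suc 0) f"
    using assms unfolding test_function_def by blast
  then show ?thesis by simp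
qed

text \<open>The complement of the closed support is open, so \<open>f\<close> agrees with 0 near
  \<open>x\<close>. Since \<open>frechet_derivative\<close> is a choice operator, its value is then
  read off from uniqueness of the derivative.\<close>

lemma frechet_derivative_eq_0_outside_support:
  assumes "x \<notin> closure {x. f x \<noteq> 0}"
  shows "frechet_derivative f (at x) = (\<lambda>h. 0)"
proof -
  have "(f has_derivative (\<lambda>h. 0)) (at x)"
  proof (rule has_derivative_transform_within_open)
    show "((\<lambda>x. 0) has_derivative (\<lambda>h. 0)) (at x)"
      by (rule has_derivative_const)
    show "x \<in> - closure {x. f x \<noteq> 0}"
      using assms by simp
    show "0 = f y" if "y \<in> - closure {x. f x \<noteq> 0}" for y
      using that closure_subset[of "{x. f x \<noteq> 0}"] by auto
  qed auto
  then show ?thesis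
    by (rule frechet_derivative_at[symmetric])
qed

text \<open>Homogeneous first-order operators with constant coefficients, \<open>L b\<close> being
  the coefficient of the derivative in direction \<open>b\<close>. The gradient, the divergence and
  the curls in both dimensions all have this shape, so the closure properties of their graph spaces
  are proved once.\<close>

definition first_order_operator ::
    "(('a::euclidean_space \<Rightarrow> 'b::euclidean_space) \<Rightarrow> 'a \<Rightarrow> 'c::euclidean_space) \<Rightarrow> bool" where
  "first_order_operator D \<longleftrightarrow> (\<exists>L. (\<forall>b. linear (L b)) \<and>
     (\<forall>\<phi> x. D \<phi> x = (\<Sum>b\<in>Basis. L b (frechet_derivative \<phi> (at x) b))))"

lemma first_order_operator_lincomb:
  assumes "first_order_operator D" "test_function \<Omega> f" "test_function \<Omega> g"
  shows "D (\<lambda>x. a *\<^sub>R f x + b *\<^sub>R g x) = (\<lambda>x. a *\<^sub>R D f x + b *\<^sub>R D g x)"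
proof -
  obtain L where L: "\<And>b. linear (L b)"
    and D: "\<And>\<phi> x. D \<phi> x = (\<Sum>b\<in>Basis. L b (frechet_derivative \<phi> (at x) b))"
    using assms(1) unfolding first_order_operator_def by blast
  show ?thesis
    by (simp add: fun_eq_iff D frechet_derivative_lincomb test_function_differentiable[OF assms(2)]
        test_function_differentiable[OF assms(3)] linear_add[OF L] linear_scale[OF L]
        sum.distrib scaleR_sum_right)
qed

lemma first_order_operator_in_L2:
  assumes "first_order_operator D" "open \<Omega>" "test_function \<Omega> f"
  shows "D f \<in> L2 \<Omega>"
proof (rule compact_support_in_L2[OF assms(2)])
  obtain L where L: "\<And>b. linear (L b)"
    and D: "\<And>\<phi> x. D \<phi> x = (\<Sum>b\<in>Basis. L b (frechet_derivative \<phi> (at x) b))"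
    using assms(1) unfolding first_order_operator_def by blast
  have "Ck (Suc 0) f"
    using assms(3) unfolding test_function_def by blast
  then have "continuous_on UNIV (\<lambda>x. frechet_derivative f (at x) b)" if "b \<in> Basis" for b
    using that by simp
  then show "continuous_on UNIV (D f)"
    unfolding D[abs_def]
    by (intro continuous_on_sum linear_continuous_on_compose[OF _ L]) 
  show "compact (closure {x. f x \<noteq> 0})"
    using assms(3) by (simp add: test_function_def)
  show "D f x = 0" if "x \<notin> closure {x. f x \<noteq> 0}" for x
    by (simp add: D frechet_derivative_eq_0_outside_support[OF that] linear_0[OF L])
qed

section \<open>Linearity of weak derivatives, graph spaces and Simpson sums\<close>

lemma has_weak_lincomb:
  assumes "first_order_operator D'" "open \<Omega>" "has_weak \<Omega> D' u w" "has_weak \<Omega> D' u' w'"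
  shows "has_weak \<Omega> D' (\<lambda>x. a *\<^sub>R u x + b *\<^sub>R u' x) (\<lambda>x. a *\<^sub>R w x + b *\<^sub>R w' x)"
  \<comment> \<open>For a fixed test function both sides of the weak identity are linear in the pair
    \<open>u\<close>, \<open>w\<close>. The test function and its image under \<open>D'\<close> lie
    in \<open>L2\<close>, which allows the integrals to be split.\<close>
  using assms(3,4)
  by (auto simp: has_weak_def L2_lincomb L2_inner_lincomb_left test_function_in_L2[OF assms(2)]
      first_order_operator_in_L2[OF assms(1,2)])

lemma graph_space0_in_L2: "u \<in> graph_space0 \<Omega> D D' \<Longrightarrow> u \<in> L2 \<Omega>"
  by (auto simp: graph_space0_def has_weak_def)

text \<open>The same combination of the two approximating sequences approximates the combined
  function, and \<open>D\<close> commutes with it, so the combined weak derivative is the limit of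
  the images.\<close>

lemma graph_space0_lincomb:
  assumes D: "first_order_operator D" and D': "first_order_operator D'" and op: "open \<Omega>"
    and "u \<in> graph_space0 \<Omega> D D'" "u' \<in> graph_space0 \<Omega> D D'"
  shows "(\<lambda>x. a *\<^sub>R u x + b *\<^sub>R u' x) \<in> graph_space0 \<Omega> D D'"
proof -
  obtain w \<phi> where w: "has_weak \<Omega> D' u w" and \<phi>: "\<And>k::nat. test_function \<Omega> (\<phi> k)"
    and l: "(\<lambda>k. L2_norm \<Omega> (\<lambda>x. \<phi> k x - u x)) \<longlonglongrightarrow> 0"
      "(\<lambda>k. L2_norm \<Omega> (\<lambda>x. D (\<phi> k) x - w x)) \<longlonglongrightarrow> 0"
    using assms(4) unfolding graph_space0_def by blast
  obtain w' \<phi>' where w': "has_weak \<Omega> D' u' w'" and \<phi>': "\<And>k::nat. test_function \<Omega> (\<phi>' k)"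
    and l': "(\<lambda>k. L2_norm \<Omega> (\<lambda>x. \<phi>' k x - u' x)) \<longlonglongrightarrow> 0"
      "(\<lambda>k. L2_norm \<Omega> (\<lambda>x. D (\<phi>' k) x - w' x)) \<longlonglongrightarrow> 0"
    using assms(5) unfolding graph_space0_def by blast
  have in_L2: "u \<in> L2 \<Omega>" "u' \<in> L2 \<Omega>" "w \<in> L2 \<Omega>" "w' \<in> L2 \<Omega>"
    using w w' by (auto simp: has_weak_def)
  let ?\<phi> = "\<lambda>k x. a *\<^sub>R \<phi> k x + b *\<^sub>R \<phi>' k x"
  have "\<forall>k. test_function \<Omega> (?\<phi> k)"
    using \<phi> \<phi>' test_function_lincomb by blast
  moreover have "(\<lambda>k. L2_norm \<Omega> (\<lambda>x. ?\<phi> k x - (a *\<^sub>R u x + b *\<^sub>R u' x))) \<longlonglongrightarrow> 0"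
    by (intro L2_norm_lincomb_tendsto_0 test_function_in_L2[OF op \<phi>] test_function_in_L2[OF op \<phi>']
        in_L2 l l')
  moreover have "(\<lambda>k. L2_norm \<Omega> (\<lambda>x. D (?\<phi> k) x - (a *\<^sub>R w x + b *\<^sub>R w' x))) \<longlonglongrightarrow> 0"
    unfolding first_order_operator_lincomb[OF D \<phi> \<phi>']
    by (intro L2_norm_lincomb_tendsto_0 first_order_operator_in_L2[OF D op \<phi>]
        first_order_operator_in_L2[OF D op \<phi>'] in_L2 l l')
  ultimately show ?thesis
    using has_weak_lincomb[OF D' op w w', of a b] unfolding graph_space0_def
    by (intro CollectI exI[of _ "\<lambda>x. a *\<^sub>R w x + b *\<^sub>R w' x"] conjI exI[of _ ?\<phi>])
qed

text \<open>Nested binary combinations with explicit coefficients, the form to which the closure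
  lemmas for \<open>L2\<close> and \<open>graph_space0\<close> apply directly.\<close>

lemma simpson_sum_eq:
  "simpson_sum u n = (\<lambda>x. 1 *\<^sub>R (1 *\<^sub>R u (n + 1) x + 4 *\<^sub>R u n x) + 1 *\<^sub>R u (n - 1) x)"
  by (simp add: simpson_sum_def)

lemma simpson_sum_in_L2:
  assumes "u (n + 1) \<in> L2 \<Omega>" "u n \<in> L2 \<Omega>" "u (n - 1) \<in> L2 \<Omega>"
  shows "simpson_sum u n \<in> L2 \<Omega>"
  unfolding simpson_sum_eq using assms by (intro L2_lincomb)

lemma simpson_sum_in_graph_space0:
  assumes "first_order_operator D" "first_order_operator D'" "open \<Omega>"
    and "u (n + 1) \<in> graph_space0 \<Omega> D D'" "u n \<in> graph_space0 \<Omega> D D'"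
      "u (n - 1) \<in> graph_space0 \<Omega> D D'"
  shows "simpson_sum u n \<in> graph_space0 \<Omega> D D'"
  unfolding simpson_sum_eq using assms by (intro graph_space0_lincomb)

section \<open>The concrete differential operators\<close>

lemma first_order_operator_grad: "first_order_operator grad"
  unfolding first_order_operator_def grad_def
  by (rule exI[of _ "\<lambda>b s. s *\<^sub>R b"]) (auto intro!: linearI simp: algebra_simps)

lemma first_order_operator_divg: "first_order_operator divg"
  unfolding first_order_operator_def divg_def
  by (rule exI[of _ "\<lambda>b v. v \<bullet> b"]) (auto intro!: linearI simp: algebra_simps)

lemma first_order_operator_uminus:
  assumes "first_order_operator D"
  shows "first_order_operator (\<lambda>\<phi> x. - D \<phi> x)"
proof -
  obtain L where L: "\<And>b. linear (L b)"
    and D: "\<And>\<phi> x. D \<phi> x = (\<Sum>b\<in>Basis. L b (frechet_derivative \<phi> (at x) b))"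
    using assms unfolding first_order_operator_def by blast
  show ?thesis
    unfolding first_order_operator_def
    by (rule exI[of _ "\<lambda>b v. - L b v"])
      (auto simp: D sum_negf intro!: linear_compose_neg L)
qed

text \<open>Links the sum over \<open>Basis\<close> in \<open>first_order_operator\<close> to the
  coordinate derivatives \<open>pd\<close> in which the curls are defined.\<close>

lemma sum_Basis_vec: "(\<Sum>b\<in>(Basis :: (real^'n) set). f b) = (\<Sum>i\<in>UNIV. f (axis i 1))"
proof -
  have "(Basis :: (real^'n) set) = (\<lambda>i. axis i 1) ` UNIV"
    by (auto simp: Basis_vec_def)
  moreover have "inj (\<lambda>i. axis i 1 :: real^'n)"
    by (auto simp: inj_on_def axis_eq_axis)
  ultimately show ?thesis
    using sum.reindex[of "\<lambda>i. axis i 1 :: real^'n" UNIV f] by (simp only: o_def)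
qed

text \<open>The curl is the sum over the coordinate directions \<open>b\<close> of the cross product
  of \<open>b\<close> with the derivative along \<open>b\<close>.\<close>

lemma first_order_operator_curl3: "first_order_operator curl3"
  unfolding first_order_operator_def
proof (intro exI conjI allI)
  show "linear (cross3 b)" for b
    by (auto intro!: linearI simp: cross3_simps)
  show "curl3 u x = (\<Sum>b\<in>Basis. cross3 b (frechet_derivative u (at x) b))" for u x
    by (simp add: sum_Basis_vec sum_3 curl3_def pd_def cross3_def vec_eq_iff forall_3 axis_def)
qed

text \<open>The coefficient is the third component of the cross product of \<open>b\<close> and
  \<open>v\<close>, both extended by a zero third coordinate.\<close>

lemma first_order_operator_scurl2: "first_order_operator scurl2"
  unfolding first_order_operator_def
proof (intro exI conjI allI)
  show "linear (\<lambda>v::real^2. b $ 1 * v $ 2 - b $ 2 * v $ 1)" for b :: "real^2"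
    by (auto intro!: linearI simp: algebra_simps)
  show "scurl2 u x = (\<Sum>b\<in>Basis. b $ 1 * frechet_derivative u (at x) b $ 2
      - b $ 2 * frechet_derivative u (at x) b $ 1)" for u x
    by (simp add: sum_Basis_vec sum_2 scurl2_def pd_def axis_def)
qed

text \<open>The coefficient consists of the first two components of the cross product of
  \<open>(b1, b2, 0)\<close> with \<open>(0, 0, s)\<close>.\<close>

lemma first_order_operator_vcurl2: "first_order_operator vcurl2"
  unfolding first_order_operator_def
proof (intro exI conjI allI)
  show "linear (\<lambda>s. s *\<^sub>R (vector [b $ 2, - b $ 1] :: real^2))" for b :: "real^2"
    by (auto intro!: linearI simp: algebra_simps)
  show "vcurl2 u x = (\<Sum>b\<in>Basis. frechet_derivative u (at x) b *\<^sub>R (vector [b $ 2, - b $ 1]))" for u x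
    by (simp add: sum_Basis_vec sum_2 vcurl2_def pd_def vec_eq_iff forall_2 axis_def)
qed

section \<open>Material weights and the energy balance\<close>

lemma material_inverse:
  assumes "material \<Omega> \<alpha>"
  shows "material \<Omega> (\<lambda>x. inverse (\<alpha> x))"
proof -
  obtain c C where c: "0 < c" and b: "\<And>x. x \<in> \<Omega> \<Longrightarrow> c \<le> \<alpha> x \<and> \<alpha> x \<le> C"
    and m: "\<alpha> \<in> borel_measurable (lebesgue_on \<Omega>)"
    using assms unfolding material_def by blast
  \<comment> \<open>The maximum with 1 keeps the lower bound positive: for empty
    \<open>\<Omega>\<close> the constant \<open>C\<close> is unconstrained.\<close>
  have "inverse (max C 1) \<le> inverse (\<alpha> x) \<and> inverse (\<alpha> x) \<le> inverse c" if "x \<in> \<Omega>" for x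
    using b[OF that] c by (auto intro!: le_imp_inverse_le)
  moreover have "0 < inverse (max C 1)"
    by simp
  ultimately show ?thesis
    unfolding material_def using m by (blast intro: borel_measurable_inverse)
qed

lemma material_integrable_inner:
  assumes "material \<Omega> \<alpha>" "u \<in> L2 \<Omega>" "v \<in> L2 \<Omega>"
  shows "integrable (lebesgue_on \<Omega>) (\<lambda>x. \<alpha> x * (u x \<bullet> v x))"
proof -
  obtain c C where c: "0 < c" and b: "\<And>x. x \<in> \<Omega> \<Longrightarrow> c \<le> \<alpha> x \<and> \<alpha> x \<le> C"
    and m: "\<alpha> \<in> borel_measurable (lebesgue_on \<Omega>)"
    using assms(1) unfolding material_def by blast
  note i = L2_integrable_inner[OF assms(2,3)]
  show ?thesis
  proof (rule Bochner_Integration.integrable_bound)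
    show "integrable (lebesgue_on \<Omega>) (\<lambda>x. C * (u x \<bullet> v x))"
      using i by simp
    show "(\<lambda>x. \<alpha> x * (u x \<bullet> v x)) \<in> borel_measurable (lebesgue_on \<Omega>)"
      using m borel_measurable_integrable[OF i] by (rule borel_measurable_times)
    have "\<bar>\<alpha> x\<bar> \<le> \<bar>C\<bar>" if "x \<in> \<Omega>" for x
      using b[OF that] c by linarith
    then show "AE x in lebesgue_on \<Omega>. norm (\<alpha> x * (u x \<bullet> v x)) \<le> norm (C * (u x \<bullet> v x))"
      by (auto intro!: AE_I2 mult_right_mono simp: abs_mult)
  qed
qed

text \<open>In the difference of consecutive energies the squared norms of the middle level cancel;
  on the right the products of the two outer levels cancel by symmetry. The factor
  \<open>2 * dt\<close> clears the denominator of the centered difference. The index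
  \<open>n - 1 + 1\<close> is the one produced by unfolding \<open>TS4_energy\<close> at
  \<open>n - 1\<close>.\<close>

lemma wt_energy_increment:
  fixes u :: "nat \<Rightarrow> 'a::euclidean_space \<Rightarrow> 'b::euclidean_space"
  assumes "material \<Omega> \<alpha>" "u (n + 1) \<in> L2 \<Omega>" "u n \<in> L2 \<Omega>" "u (n - 1) \<in> L2 \<Omega>" "1 \<le> n" "0 < dt"
  shows "wt_norm_sq \<Omega> \<alpha> (\<lambda>x. u (n + 1) x + u n x) + 2 * wt_inner \<Omega> \<alpha> (u (n + 1)) (u n)
    - (wt_norm_sq \<Omega> \<alpha> (\<lambda>x. u (n - 1 + 1) x + u (n - 1) x)
        + 2 * wt_inner \<Omega> \<alpha> (u (n - 1 + 1)) (u (n - 1)))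
    = 2 * dt * wt_inner \<Omega> \<alpha> (centered_diff dt u n) (simpson_sum u n)"
proof -
  obtain a b c where abc: "a = u (n + 1)" "b = u n" "c = u (n - 1)"
    by blast
  \<comment> \<open>Subtraction on naturals is truncated, so this depends on
    \<open>1 \<le> n\<close>.\<close>
  have n: "n - 1 + 1 = n"
    using assms(5) by simp
  define I where "I v w = (LINT x|lebesgue_on \<Omega>. \<alpha> x * (v x \<bullet> w x))" for v w :: "'a \<Rightarrow> 'b"
  have int: "integrable (lebesgue_on \<Omega>) (\<lambda>x. \<alpha> x * (v x \<bullet> w x))" if "v \<in> {a, b, c}" "w \<in> {a, b, c}" for v w
    using that assms(2-4) by (intro material_integrable_inner[OF assms(1)]) (auto simp: abc)
  have sq: "wt_norm_sq \<Omega> \<alpha> (\<lambda>x. v x + w x) = I v v + 2 * I v w + I w w"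
    if "v \<in> {a, b, c}" "w \<in> {a, b, c}" for v w
  proof -
    have "(\<alpha> x *\<^sub>R (v x + w x)) \<bullet> (v x + w x)
        = \<alpha> x * (v x \<bullet> v x) + 2 * (\<alpha> x * (v x \<bullet> w x)) + \<alpha> x * (w x \<bullet> w x)" for x
      by (simp add: inner_add inner_commute algebra_simps)
    then show ?thesis
      using int that by (simp add: wt_norm_sq_def wt_inner_def L2_inner_def I_def)
  qed
  have "(\<alpha> x *\<^sub>R ((a x - c x) /\<^sub>R (2 * dt))) \<bullet> (a x + 4 *\<^sub>R b x + c x)
      = (\<alpha> x * (a x \<bullet> a x) + 4 * (\<alpha> x * (a x \<bullet> b x)) - 4 * (\<alpha> x * (b x \<bullet> c x))
          - \<alpha> x * (c x \<bullet> c x)) / (2 * dt)" for x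
    using assms(6) by (simp add: inner_add inner_diff inner_commute field_simps)
  then have "wt_inner \<Omega> \<alpha> (centered_diff dt u n) (simpson_sum u n) = (LINT x|lebesgue_on \<Omega>.
      (\<alpha> x * (a x \<bullet> a x) + 4 * (\<alpha> x * (a x \<bullet> b x)) - 4 * (\<alpha> x * (b x \<bullet> c x))
          - \<alpha> x * (c x \<bullet> c x)) / (2 * dt))"
    unfolding wt_inner_def L2_inner_def centered_diff_def simpson_sum_def abc[symmetric]
    by (simp only:)
  also have "\<dots> = (I a a + 4 * I a b - 4 * I b c - I c c) / (2 * dt)"
    using int by (simp add: I_def)
  finally have "2 * dt * wt_inner \<Omega> \<alpha> (centered_diff dt u n) (simpson_sum u n)
      = I a a + 4 * I a b - 4 * I b c - I c c"
    using assms(6) by simp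
  moreover have "wt_inner \<Omega> \<alpha> v w = I v w" for v w
    by (simp add: wt_inner_def L2_inner_def I_def)
  ultimately show ?thesis
    unfolding n abc[symmetric] by (simp add: sq)
qed

text \<open>The operators \<open>C\<close>, \<open>C'\<close> and the magnetic space
  \<open>V\<close> stay abstract so that both dimensions are instances. Of \<open>V\<close> it is
  only asked that it lie in \<open>L2\<close> and contain the Simpson sums of its elements.\<close>

lemma TS4_energy_conserved:
  assumes dom: "lipschitz_domain \<Omega>" and mat: "material \<Omega> \<epsilon>" "material \<Omega> \<mu>"
    and C: "first_order_operator C" and C': "first_order_operator C'"
    and V: "V \<subseteq> L2 \<Omega>"
      "\<And>u n. u (n + 1) \<in> V \<Longrightarrow> u n \<in> V \<Longrightarrow> u (n - 1) \<in> V \<Longrightarrow> simpson_sum u n \<in> V"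
    and dt: "0 < dt" and scheme: "TS4_scheme \<Omega> C C' V \<epsilon> \<mu> dt N p E H" and n: "1 \<le> n" "n < N"
  shows "TS4_energy \<Omega> \<epsilon> \<mu> p E H n = TS4_energy \<Omega> \<epsilon> \<mu> p E H (n - 1)"
proof -
  have op: "open \<Omega>"
    using dom by (simp add: lipschitz_domain_def)
  let ?p = "simpson_sum p n" and ?E = "simpson_sum E n" and ?H = "simpson_sum H n"
  have "p k \<in> H1_0 \<Omega> \<and> E k \<in> graph_space0 \<Omega> C C' \<and> H k \<in> V" if "k \<le> N" for k
    using scheme that unfolding TS4_scheme_def by blast
  from this[of "n + 1"] this[of n] this[of "n - 1"] n
  have p: "p (n + 1) \<in> H1_0 \<Omega>" "p n \<in> H1_0 \<Omega>" "p (n - 1) \<in> H1_0 \<Omega>"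
    and E: "E (n + 1) \<in> graph_space0 \<Omega> C C'" "E n \<in> graph_space0 \<Omega> C C'"
      "E (n - 1) \<in> graph_space0 \<Omega> C C'"
    and H: "H (n + 1) \<in> V" "H n \<in> V" "H (n - 1) \<in> V"
    by auto
  have "?p \<in> H1_0 \<Omega>"
    using p op first_order_operator_grad first_order_operator_uminus[OF first_order_operator_divg]
    unfolding H1_0_def by (intro simpson_sum_in_graph_space0)
  moreover have "?E \<in> graph_space0 \<Omega> C C'"
    using E op C C' by (intro simpson_sum_in_graph_space0)
  moreover have "?H \<in> V"
    using H by (rule V)
  ultimately have eqs:
    "wt_inner \<Omega> (\<lambda>x. inverse (\<epsilon> x)) (centered_diff dt p n) ?p
      - 1 / 6 * L2_inner \<Omega> ?E (weak \<Omega> grad_adj ?p) = 0"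
    "1 / 6 * L2_inner \<Omega> (weak \<Omega> grad_adj ?p) ?E + wt_inner \<Omega> \<epsilon> (centered_diff dt E n) ?E
      - 1 / 6 * L2_inner \<Omega> ?H (weak \<Omega> C' ?E) = 0"
    "wt_inner \<Omega> \<mu> (centered_diff dt H n) ?H + 1 / 6 * L2_inner \<Omega> (weak \<Omega> C' ?E) ?H = 0"
    using scheme n unfolding TS4_scheme_def by blast+
  \<comment> \<open>Although \<open>weak\<close> is a choice operator, the terms that cancel contain
    literally the same chosen function: the weak gradient of \<open>?p\<close> paired with
    \<open>?E\<close>, and the weak curl of \<open>?E\<close> paired with \<open>?H\<close>.
    Symmetry of the inner product therefore suffices.\<close>
  then have "wt_inner \<Omega> (\<lambda>x. inverse (\<epsilon> x)) (centered_diff dt p n) ?p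
      + wt_inner \<Omega> \<epsilon> (centered_diff dt E n) ?E + wt_inner \<Omega> \<mu> (centered_diff dt H n) ?H = 0"
    using L2_inner_commute[of \<Omega> ?E "weak \<Omega> grad_adj ?p"] L2_inner_commute[of \<Omega> ?H "weak \<Omega> C' ?E"]
    by linarith
  then have "2 * dt * wt_inner \<Omega> (\<lambda>x. inverse (\<epsilon> x)) (centered_diff dt p n) ?p
      + 2 * dt * wt_inner \<Omega> \<epsilon> (centered_diff dt E n) ?E
      + 2 * dt * wt_inner \<Omega> \<mu> (centered_diff dt H n) ?H = 0"
    by (metis distrib_left mult_zero_right)
  moreover note wt_energy_increment[where u = p, OF material_inverse[OF mat(1)]
      p[unfolded H1_0_def, THEN graph_space0_in_L2] n(1) dt]
    wt_energy_increment[where u = E, OF mat(1) E[THEN graph_space0_in_L2] n(1) dt]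
    wt_energy_increment[where u = H, OF mat(2) H[THEN subsetD[OF V(1)]] n(1) dt]
  ultimately show ?thesis
    unfolding TS4_energy_def by linarith
qed

theorem theorem6:
  "(\<forall>(\<Omega> :: (real^2) set) \<epsilon> \<mu> T p0 E0 (H0 :: real^2 \<Rightarrow> real) p E H.
      lipschitz_domain \<Omega> \<longrightarrow> material \<Omega> \<epsilon> \<longrightarrow> material \<Omega> \<mu> \<longrightarrow> T > 0 \<longrightarrow>
      has_weak \<Omega> divg_adj (\<lambda>x. \<epsilon> x *\<^sub>R E0 x) p0 \<longrightarrow>
      maxwell_solution \<Omega> scurl2 vcurl2 (L2 \<Omega>) \<epsilon> \<mu> T p0 E0 H0 p E H \<longrightarrow>
      positive_inner_products \<Omega> \<epsilon> \<mu> T p E H \<longrightarrow>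
      (\<exists>\<delta>>0. \<forall>dt N ph Eh Hh. 0 < dt \<longrightarrow> dt < \<delta> \<longrightarrow> \<bar>real N * dt - T\<bar> \<le> dt \<longrightarrow>
         TS4_scheme \<Omega> scurl2 vcurl2 (L2 \<Omega>) \<epsilon> \<mu> dt N ph Eh Hh \<longrightarrow>
         (\<forall>n. 1 \<le> n \<and> n < N \<longrightarrow>
            TS4_energy \<Omega> \<epsilon> \<mu> ph Eh Hh n = TS4_energy \<Omega> \<epsilon> \<mu> ph Eh Hh (n - 1)))) \<and>
   (\<forall>(\<Omega> :: (real^3) set) \<epsilon> \<mu> T p0 E0 (H0 :: real^3 \<Rightarrow> real^3) p E H.
      lipschitz_domain \<Omega> \<longrightarrow> material \<Omega> \<epsilon> \<longrightarrow> material \<Omega> \<mu> \<longrightarrow> T > 0 \<longrightarrow>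
      has_weak \<Omega> divg_adj (\<lambda>x. \<epsilon> x *\<^sub>R E0 x) p0 \<longrightarrow>
      has_weak \<Omega> divg_adj (\<lambda>x. \<mu> x *\<^sub>R H0 x) (\<lambda>x. 0) \<longrightarrow>
      maxwell_solution \<Omega> curl3 curl3 (Hdiv_0 \<Omega>) \<epsilon> \<mu> T p0 E0 H0 p E H \<longrightarrow>
      positive_inner_products \<Omega> \<epsilon> \<mu> T p E H \<longrightarrow>
      (\<exists>\<delta>>0. \<forall>dt N ph Eh Hh. 0 < dt \<longrightarrow> dt < \<delta> \<longrightarrow> \<bar>real N * dt - T\<bar> \<le> dt \<longrightarrow>
         TS4_scheme \<Omega> curl3 curl3 (Hdiv_0 \<Omega>) \<epsilon> \<mu> dt N ph Eh Hh \<longrightarrow>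
         (\<forall>n. 1 \<le> n \<and> n < N \<longrightarrow>
            TS4_energy \<Omega> \<epsilon> \<mu> ph Eh Hh n = TS4_energy \<Omega> \<epsilon> \<mu> ph Eh Hh (n - 1))))"
proof (intro conjI allI impI)
  fix \<Omega> :: "(real^2) set" and \<epsilon> \<mu>
  assume "lipschitz_domain \<Omega>" "material \<Omega> \<epsilon>" "material \<Omega> \<mu>"
  then show "\<exists>\<delta>>0. \<forall>dt N ph Eh Hh. 0 < dt \<longrightarrow> dt < \<delta> \<longrightarrow> \<bar>real N * dt - T\<bar> \<le> dt \<longrightarrow>
         TS4_scheme \<Omega> scurl2 vcurl2 (L2 \<Omega>) \<epsilon> \<mu> dt N ph Eh Hh \<longrightarrow>
         (\<forall>n. 1 \<le> n \<and> n < N \<longrightarrow>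
            TS4_energy \<Omega> \<epsilon> \<mu> ph Eh Hh n = TS4_energy \<Omega> \<epsilon> \<mu> ph Eh Hh (n - 1))" for T
    \<comment> \<open>In two dimensions the magnetic space is all of \<open>L2\<close>, so its
      closure under Simpson sums is linearity of \<open>L2\<close>. Conservation holds for every
      positive \<open>dt\<close>, hence the threshold 1 is an arbitrary choice.\<close>
    using TS4_energy_conserved[OF _ _ _ first_order_operator_scurl2 first_order_operator_vcurl2
        order_refl simpson_sum_in_L2]
    by (intro exI[of _ 1]) auto
next
  fix \<Omega> :: "(real^3) set" and \<epsilon> \<mu>
  assume dom: "lipschitz_domain \<Omega>" "material \<Omega> \<epsilon>" "material \<Omega> \<mu>"
  have op: "open \<Omega>"
    using dom(1) by (simp add: lipschitz_domain_def)
  have V: "Hdiv_0 \<Omega> \<subseteq> L2 \<Omega>"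
    unfolding Hdiv_0_def by (auto dest: graph_space0_in_L2)
  \<comment> \<open>The magnetic space is again a graph space, now of the divergence with adjoint
    minus the gradient, so the closure lemma used for the other two fields applies.\<close>
  have S: "simpson_sum u n \<in> Hdiv_0 \<Omega>"
    if "u (n + 1) \<in> Hdiv_0 \<Omega>" "u n \<in> Hdiv_0 \<Omega>" "u (n - 1) \<in> Hdiv_0 \<Omega>" for u n
    using that op first_order_operator_divg first_order_operator_uminus[OF first_order_operator_grad]
    unfolding Hdiv_0_def by (intro simpson_sum_in_graph_space0)
  show "\<exists>\<delta>>0. \<forall>dt N ph Eh Hh. 0 < dt \<longrightarrow> dt < \<delta> \<longrightarrow> \<bar>real N * dt - T\<bar> \<le> dt \<longrightarrow>
         TS4_scheme \<Omega> curl3 curl3 (Hdiv_0 \<Omega>) \<epsilon> \<mu> dt N ph Eh Hh \<longrightarrow>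
         (\<forall>n. 1 \<le> n \<and> n < N \<longrightarrow>
            TS4_energy \<Omega> \<epsilon> \<mu> ph Eh Hh n = TS4_energy \<Omega> \<epsilon> \<mu> ph Eh Hh (n - 1))" for T
    using TS4_energy_conserved[OF dom first_order_operator_curl3 first_order_operator_curl3 V S]
    by (intro exI[of _ 1]) auto
qed

end
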